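(* Let $\mathcal G$ be an $(n,c,k,\mu)$-admissible hypergraph. Then $\mathcal G$ has a spanning Euler tour if at least one of the following holds: (i) $\delta_2(\mathcal G)\ge k$; (ii) $\delta_3(\mathcal G)\ge 1$ and $n\ge k^2-3k+5$; (iii) $\delta_r(\mathcal G)\ge 1$ for some integer $r$ with $4\le r\le k$.
   Context: A hypergraph $\mathcal G=(V,E)$ consists of a finite vertex set $V$ and a finite multiset $E$ of nonempty subsets of $V$ (edges; repeated edges allowed). $\mu(\mathcal G)$ is the maximum multiplicity of an edge in $E$; $\operatorname{rk}(\mathcal G)=\max\{|e|:e\in E\}$, $\operatorname{crk}(\mathcal G)=\min\{|e|:e\in E\}$. For $T\subseteq V$, $\deg(T)$ is the number of edges (counted with multiplicity) containing $T$, and $\delta_t(\mathcal G)=\min\{\deg(T):T\subseteq V,|T|=t\}$. An $n$-vertex hypergraph $\mathcal G$ is $(n,c,k,\mu)$-admissible if $\operatorname{crk}(\mathcal G)=c\ge 3$, $\operatorname{rk}(\mathcal G)=k$, $\mu(\mathcal G)=\mu$, and $n\ge g(c,k,\mu)$, where $g(3,3,\mu)=7$; $g(3,4,\mu)=10$; $g(c,k,\mu)=\binom{k}{2}+1$ if $c\ge 4$ and $k\le 2c-2$; $g(c,k,\mu)=(4c^2+k^2-3k+2)/(4c-2k+2)$ if $c\ge3$ and $2c-1\le k\le 2c$; and $g(c,k,\mu)=2\mu(k-1)(2^{k-c-1}-2^c+1)+\binom{k}{2}+1$ if $k>2c$. A closed walk is a cyclic sequence $v_1,e_1,v_2,e_2,\dots,v_t,e_t$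 of vertices and edges with $\{v_i,v_{i+1}\}\subseteq e_i$ and $v_i\ne v_{i+1}$ for all $i$ (indices modulo $t$). An Euler tour is a closed walk in which every edge of $\mathcal G$ (each member of the multiset $E$) occurs exactly once among $e_1,\dots,e_t$; it is spanning if every vertex of $\mathcal G$ occurs among $v_1,\dots,v_t$. *)

theory Defs
  imports Complex_Main "HOL-Library.Multiset"
begin

definition hypergraph :: "'a set \<Rightarrow> 'a set multiset \<Rightarrow> bool" where
  "hypergraph V E \<longleftrightarrow> finite V \<and> (\<forall>e\<in>#E. e \<noteq> {} \<and> e \<subseteq> V)"

definition mult_max :: "'a set multiset \<Rightarrow> nat" where
  "mult_max E = Max ((\<lambda>e. count E e) ` set_mset E)"

definition rk :: "'a set multiset \<Rightarrow> nat" where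
  "rk E = Max (card ` set_mset E)"

definition crk :: "'a set multiset \<Rightarrow> nat" where
  "crk E = Min (card ` set_mset E)"

definition hdeg :: "'a set multiset \<Rightarrow> 'a set \<Rightarrow> nat" where
  "hdeg E T = size (filter_mset (\<lambda>e. T \<subseteq> e) E)"

definition delta :: "'a set \<Rightarrow> 'a set multiset \<Rightarrow> nat \<Rightarrow> nat" where
  "delta V E t = Min ((hdeg E) ` {T. T \<subseteq> V \<and> card T = t})"

definition g_bound :: "nat \<Rightarrow> nat \<Rightarrow> nat \<Rightarrow> real" where
  "g_bound c k \<mu> =
    (if c = 3 \<and> k = 3 then 7
     else if c = 3 \<and> k = 4 then 10
     else if c \<ge> 4 \<and> k \<le> 2*c - 2 then real (k choose 2) + 1
     else if c \<ge> 3 \<and> 2*c - 1 \<le> k \<and> k \<le> 2*c then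
       (4 * real c ^ 2 + real k ^ 2 - 3 * real k + 2) / (4 * real c - 2 * real k + 2)
     else 2 * real \<mu> * (real k - 1) * (2 ^ (k - c - 1) - 2 ^ c + 1) + real (k choose 2) + 1)"

definition admissible :: "'a set \<Rightarrow> 'a set multiset \<Rightarrow> nat \<Rightarrow> nat \<Rightarrow> nat \<Rightarrow> nat \<Rightarrow> bool" where
  "admissible V E n c k \<mu> \<longleftrightarrow> hypergraph V E \<and> E \<noteq> {#} \<and> card V = n \<and>
     crk E = c \<and> c \<ge> 3 \<and> rk E = k \<and> mult_max E = \<mu> \<and> real n \<ge> g_bound c k \<mu>"

definition closed_walk :: "'a list \<Rightarrow> 'a set list \<Rightarrow> bool" where
  "closed_walk vs es \<longleftrightarrow> length vs = length es \<and> length vs > 0 \<and>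
     (\<forall>i < length vs. {vs ! i, vs ! ((i + 1) mod length vs)} \<subseteq> es ! i \<and>
                      vs ! i \<noteq> vs ! ((i + 1) mod length vs))"

definition euler_tour :: "'a set multiset \<Rightarrow> 'a list \<Rightarrow> 'a set list \<Rightarrow> bool" where
  "euler_tour E vs es \<longleftrightarrow> closed_walk vs es \<and> mset es = E"

definition has_spanning_euler_tour :: "'a set \<Rightarrow> 'a set multiset \<Rightarrow> bool" where
  "has_spanning_euler_tour V E \<longleftrightarrow> (\<exists>vs es. euler_tour E vs es \<and> V \<subseteq> set vs)"

end

theory Submission
  imports Defs
begin

text \<open>
  An Euler tour amounts to choosing two vertices of every edge such that the resulting multigraph on
  \<open>V\<close> is connected with all degrees even; it is then spanning as soon as it has no isolated vertex.
  Double counting and the lower bound on \<open>n\<close> reduce (ii) and (iii) to (i): every pair of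
  vertices lies in at least \<open>k\<close> edges. Since every edge covers at most \<open>k(k-1)\<close> ordered pairs,
  it follows that at least \<open>2(p-1)\<close> edges cross any partition of \<open>V\<close> into \<open>p\<close> parts. By a
  matroid-union argument one can therefore pick a pair in every edge and split the edges into two classes
  \<open>J\<close> and \<open>I - J\<close> whose pairs both connect \<open>V\<close>. The pairs of \<open>J\<close> are kept. An edge outside
  \<open>J\<close> has a third vertex \<open>x\<close>, and its pair \<open>{a, b}\<close> is replaced by \<open>{x, a}\<close> or \<open>{x, b}\<close>;
  exchanging the two alternatives flips the parities of \<open>a\<close> and \<open>b\<close>, so the connectivity of
  the second class allows one to make all degrees even.
\<close>

section \<open>Transversals of polymatroids\<close>

text \<open>No value at the empty set is prescribed, so contracting an element is just
  \<open>\<lambda>X. r (insert g X)\<close>, without subtracting \<open>r {g}\<close>.\<close>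

definition polymatroid_on :: "'b set \<Rightarrow> ('b set \<Rightarrow> int) \<Rightarrow> bool" where
  "polymatroid_on P r \<longleftrightarrow>
     (\<forall>X Y. X \<subseteq> Y \<longrightarrow> Y \<subseteq> P \<longrightarrow> r X \<le> r Y) \<and>
     (\<forall>X Y. X \<subseteq> P \<longrightarrow> Y \<subseteq> P \<longrightarrow> r (X \<union> Y) + r (X \<inter> Y) \<le> r X + r Y)"

text \<open>Any common subset \<open>Z\<close> may replace the intersection. This is needed because
  the union of the \<open>A i\<close> over \<open>R \<inter> S\<close> can be smaller than the
  intersection of the unions over \<open>R\<close> and \<open>S\<close>.\<close>

lemma polymatroid_on_uncross:
  assumes "polymatroid_on P r" "X \<subseteq> P" "Y \<subseteq> P" "Z \<subseteq> X" "Z \<subseteq> Y"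
  shows "r (X \<union> Y) + r Z \<le> r X + r Y"
proof -
  have "r Z \<le> r (X \<inter> Y)" "r (X \<union> Y) + r (X \<inter> Y) \<le> r X + r Y"
    using assms unfolding polymatroid_on_def by (meson Int_greatest inf.coboundedI1, blast)
  then show ?thesis by linarith
qed

text \<open>Contraction of \<open>g\<close> up to a constant; it keeps track of an element that has
  already been selected.\<close>

lemma polymatroid_on_insert:
  assumes "polymatroid_on P r" "g \<in> P"
  shows "polymatroid_on P (\<lambda>X. r (insert g X))"
  unfolding polymatroid_on_def
proof (intro conjI allI impI)
  fix X Y assume "X \<subseteq> Y" "Y \<subseteq> P"
  then show "r (insert g X) \<le> r (insert g Y)"
    using assms unfolding polymatroid_on_def by (meson insert_mono insert_subset)
next
  fix X Y assume "X \<subseteq> P" "Y \<subseteq> P"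
  then have "r (insert g X \<union> insert g Y) + r (insert g (X \<inter> Y)) \<le> r (insert g X) + r (insert g Y)"
    using assms by (intro polymatroid_on_uncross) auto
  then show "r (insert g (X \<union> Y)) + r (insert g (X \<inter> Y)) \<le> r (insert g X) + r (insert g Y)"
    by simp
qed

lemma card_Diff_Un_Int:
  assumes "finite I" "R \<subseteq> I" "S \<subseteq> I"
  shows "int (card (I - R)) + int (card (I - S)) = int (card (I - (R \<union> S))) + int (card (I - R \<inter> S))"
proof -
  have "(I - R) \<union> (I - S) = I - R \<inter> S" "(I - R) \<inter> (I - S) = I - (R \<union> S)" by auto
  then show ?thesis using card_Un_Int[of "I - R" "I - S"] assms by simp
qed

text \<open>If every single element \<open>g\<close> of a set is blocked by some index set \<open>R\<close>, the blocking sets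
  uncross to one that blocks the whole set at once.\<close>

lemma blocked_union:
  fixes r s :: "'b set \<Rightarrow> int"
  assumes "finite G" "G \<noteq> {}" "G \<subseteq> P" "finite I" "J \<subseteq> I"
    and A: "\<And>i. i \<in> I \<Longrightarrow> A i \<subseteq> P"
    and r: "polymatroid_on P r" and s: "polymatroid_on P s"
    and K: "\<And>R. R \<subseteq> I \<Longrightarrow> K \<le> int (card (I - R)) + r (\<Union>(A ` R)) + s (\<Union>(A ` R))"
    and blocked: "\<And>g. g \<in> G \<Longrightarrow>
      \<exists>R\<subseteq>J. int (card (I - R)) + r (insert g (\<Union>(A ` R))) + s (\<Union>(A ` R)) \<le> K"
  shows "\<exists>R\<subseteq>J. int (card (I - R)) + r (G \<union> \<Union>(A ` R)) + s (\<Union>(A ` R)) \<le> K"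
  using assms(1-3) blocked
proof (induction G rule: finite_ne_induct)
  case (singleton g)
  then show ?case by simp
next
  case (insert g G)
  from insert.IH insert.prems obtain R where R: "R \<subseteq> J"
    "int (card (I - R)) + r (G \<union> \<Union>(A ` R)) + s (\<Union>(A ` R)) \<le> K" by auto
  from insert.prems(2)[of g] obtain S where S: "S \<subseteq> J"
    "int (card (I - S)) + r (insert g (\<Union>(A ` S))) + s (\<Union>(A ` S)) \<le> K" by auto
  have sub: "\<Union>(A ` R) \<subseteq> P" "\<Union>(A ` S) \<subseteq> P" using A R S assms(5) by blast+
  have un: "insert g G \<union> \<Union>(A ` (R \<union> S)) = (G \<union> \<Union>(A ` R)) \<union> insert g (\<Union>(A ` S))"
    "\<Union>(A ` (R \<union> S)) = \<Union>(A ` R) \<union> \<Union>(A ` S)" by auto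
  \<comment> \<open>The terms of \<open>R\<close> and \<open>S\<close> sum to at most
    \<open>2 * K\<close> and dominate those of \<open>R \<union> S\<close> and
    \<open>R \<inter> S\<close>. The share of \<open>R \<inter> S\<close> is at least
    \<open>K\<close>, which leaves at most \<open>K\<close> for \<open>R \<union> S\<close>.\<close>
  have "r (insert g G \<union> \<Union>(A ` (R \<union> S))) + r (\<Union>(A ` (R \<inter> S)))
      \<le> r (G \<union> \<Union>(A ` R)) + r (insert g (\<Union>(A ` S)))"
    unfolding un(1) using sub insert.prems(1) by (intro polymatroid_on_uncross[OF r]) auto
  moreover have "s (\<Union>(A ` (R \<union> S))) + s (\<Union>(A ` (R \<inter> S))) \<le> s (\<Union>(A ` R)) + s (\<Union>(A ` S))"
    unfolding un(2) using sub by (intro polymatroid_on_uncross[OF s]) auto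
  moreover have "int (card (I - R)) + int (card (I - S)) = int (card (I - (R \<union> S))) + int (card (I - R \<inter> S))"
    using R S assms(4,5) by (intro card_Diff_Un_Int) auto
  moreover have "K \<le> int (card (I - R \<inter> S)) + r (\<Union>(A ` (R \<inter> S))) + s (\<Union>(A ` (R \<inter> S)))"
    using R S assms(5) by (intro K) auto
  ultimately have "int (card (I - (R \<union> S))) + r (insert g G \<union> \<Union>(A ` (R \<union> S))) + s (\<Union>(A ` (R \<union> S))) \<le> K"
    using R(2) S(2) by linarith
  then show ?case using R(1) S(1) by (intro exI[of _ "R \<union> S"]) auto
qed

text \<open>A Rado-type theorem for two polymatroids at once. Induction on \<open>I\<close>: for one
  index \<open>e\<close> some \<open>g\<close> in \<open>A e\<close> is fixed and contracted in
  \<open>r\<close> or in \<open>s\<close>; uncrossing shows that a suitable choice preserves the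
  rank condition.\<close>

lemma polymatroid_transversal_partition:
  fixes r s :: "'b set \<Rightarrow> int"
  assumes "finite I"
    and "\<And>i. i \<in> I \<Longrightarrow> A i \<subseteq> P" "\<And>i. i \<in> I \<Longrightarrow> A i \<noteq> {}" "\<And>i. i \<in> I \<Longrightarrow> finite (A i)"
    and "polymatroid_on P r" "polymatroid_on P s"
    and "\<And>R. R \<subseteq> I \<Longrightarrow> K \<le> int (card (I - R)) + r (\<Union>(A ` R)) + s (\<Union>(A ` R))"
  shows "\<exists>f J. (\<forall>i\<in>I. f i \<in> A i) \<and> J \<subseteq> I \<and> K \<le> r (f ` J) + s (f ` (I - J))"
  using assms
proof (induction I arbitrary: r s rule: finite_induct)
  case empty
  then show ?case by simp
next
  case (insert e I)
  note K = insert.prems(6) and r = insert.prems(4) and s = insert.prems(5)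
  have Ae: "finite (A e)" "A e \<noteq> {}" "A e \<subseteq> P" using insert.prems by auto
  let ?c = "\<lambda>R. int (card (insert e I - R))"
  have c: "?c R = int (card (I - R)) + 1" if "R \<subseteq> I" for R
  proof -
    have "insert e I - R = insert e (I - R)" using that insert.hyps by auto
    then show ?thesis using insert.hyps by simp
  qed
  \<comment> \<open>\<open>?c R\<close> still counts \<open>e\<close>, so the strict inequality is
    exactly the rank condition for \<open>I\<close> after contracting \<open>g\<close> in
    \<open>r\<close> or in \<open>s\<close>.\<close>
  have "\<exists>g\<in>A e. (\<forall>R\<subseteq>I. K < ?c R + r (insert g (\<Union>(A ` R))) + s (\<Union>(A ` R))) \<or>
                (\<forall>R\<subseteq>I. K < ?c R + r (\<Union>(A ` R)) + s (insert g (\<Union>(A ` R))))"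
  proof (rule ccontr)
    assume contra: "\<not> ?thesis"
    have "\<exists>R\<subseteq>I. ?c R + r (A e \<union> \<Union>(A ` R)) + s (\<Union>(A ` R)) \<le> K"
    proof (rule blocked_union[OF Ae _ _ _ r s K])
      fix g assume "g \<in> A e"
      with contra show "\<exists>R\<subseteq>I. ?c R + r (insert g (\<Union>(A ` R))) + s (\<Union>(A ` R)) \<le> K"
        by (meson not_le)
    qed (use insert.hyps(1) insert.prems(1) in auto)
    then obtain R where R: "R \<subseteq> I" "?c R + r (A e \<union> \<Union>(A ` R)) + s (\<Union>(A ` R)) \<le> K" by blast
    have "\<exists>R\<subseteq>I. ?c R + s (A e \<union> \<Union>(A ` R)) + r (\<Union>(A ` R)) \<le> K"
    proof (rule blocked_union[OF Ae _ _ _ s r])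
      fix g assume "g \<in> A e"
      with contra have "\<exists>R\<subseteq>I. ?c R + r (\<Union>(A ` R)) + s (insert g (\<Union>(A ` R))) \<le> K"
        by (meson not_le)
      then show "\<exists>R\<subseteq>I. ?c R + s (insert g (\<Union>(A ` R))) + r (\<Union>(A ` R)) \<le> K"
        by (simp add: algebra_simps)
    next
      fix R assume "R \<subseteq> insert e I"
      from K[OF this] show "K \<le> ?c R + s (\<Union>(A ` R)) + r (\<Union>(A ` R))" by simp
    qed (use insert.hyps(1) insert.prems(1) in auto)
    then obtain S where S: "S \<subseteq> I" "?c S + s (A e \<union> \<Union>(A ` S)) + r (\<Union>(A ` S)) \<le> K" by blast
    have sub: "\<Union>(A ` R) \<subseteq> P" "\<Union>(A ` S) \<subseteq> P" using insert.prems(1) R S by blast+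
    \<comment> \<open>Inserting \<open>e\<close> into \<open>R \<union> S\<close> costs nothing in
      \<open>r\<close> and \<open>s\<close>, since \<open>A e\<close> already occurs once with each
      of them, but it lowers the count by one. Uncrossing then yields
      \<open>2 * K + 1 \<le> 2 * K\<close>.\<close>
    let ?U = "\<Union>(A ` insert e (R \<union> S))" and ?N = "\<Union>(A ` (R \<inter> S))"
    have un: "?U = (A e \<union> \<Union>(A ` R)) \<union> \<Union>(A ` S)" "?U = \<Union>(A ` R) \<union> (A e \<union> \<Union>(A ` S))" by auto
    have "r ?U + r ?N \<le> r (A e \<union> \<Union>(A ` R)) + r (\<Union>(A ` S))"
      unfolding un(1) using sub Ae by (intro polymatroid_on_uncross[OF r]) auto
    moreover have "s ?U + s ?N \<le> s (\<Union>(A ` R)) + s (A e \<union> \<Union>(A ` S))"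
      unfolding un(2) using sub Ae by (intro polymatroid_on_uncross[OF s]) auto
    moreover have "?c R + ?c S = ?c (R \<union> S) + ?c (R \<inter> S)"
      using R S insert.hyps by (intro card_Diff_Un_Int) auto
    moreover have "?c (insert e (R \<union> S)) + 1 = ?c (R \<union> S)"
    proof -
      have "insert e I - insert e (R \<union> S) = I - (R \<union> S)" using insert.hyps by auto
      then show ?thesis using c[of "R \<union> S"] R S by simp
    qed
    moreover have "K \<le> ?c (insert e (R \<union> S)) + r ?U + s ?U" using R S by (intro K) auto
    moreover have "K \<le> ?c (R \<inter> S) + r ?N + s ?N" using R S by (intro K) auto
    ultimately show False using R(2) S(2) by linarith
  qed
  then obtain g where g: "g \<in> A e" and
    disj: "(\<forall>R\<subseteq>I. K < ?c R + r (insert g (\<Union>(A ` R))) + s (\<Union>(A ` R))) \<or>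
           (\<forall>R\<subseteq>I. K < ?c R + r (\<Union>(A ` R)) + s (insert g (\<Union>(A ` R))))" by blast
  have gP: "g \<in> P" using g Ae by auto
  have img: "(f(e := g)) ` J = f ` J" if "J \<subseteq> I" for f J
    using that insert.hyps by (intro image_cong) auto
  from disj show ?case
  proof
    \<comment> \<open>Here \<open>g\<close> is contracted in \<open>r\<close>, so \<open>e\<close>
      joins \<open>J\<close>; in the other case \<open>e\<close> stays outside
      \<open>J\<close>.\<close>
    assume *: "\<forall>R\<subseteq>I. K < ?c R + r (insert g (\<Union>(A ` R))) + s (\<Union>(A ` R))"
    have "\<exists>f J. (\<forall>i\<in>I. f i \<in> A i) \<and> J \<subseteq> I \<and> K \<le> r (insert g (f ` J)) + s (f ` (I - J))"
    proof (rule insert.IH)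
      fix R assume R: "R \<subseteq> I"
      show "K \<le> int (card (I - R)) + r (insert g (\<Union>(A ` R))) + s (\<Union>(A ` R))"
        using *[rule_format, OF R] c[OF R] by linarith
    qed (use insert.prems(1-3) r s polymatroid_on_insert[OF r gP] polymatroid_on_insert[OF s gP] in auto)
    then obtain f J where f: "\<forall>i\<in>I. f i \<in> A i" "J \<subseteq> I" "K \<le> r (insert g (f ` J)) + s (f ` (I - J))"
      by blast
    have "insert e I - insert e J = I - J" using insert.hyps by auto
    moreover from this have "(f(e := g)) ` insert e J = insert g (f ` J)"
      using img[OF f(2), of f] by (simp del: fun_upd_apply add: fun_upd_same)
    moreover have "(f(e := g)) ` (I - J) = f ` (I - J)" by (rule img) auto
    ultimately have "K \<le> r ((f(e := g)) ` insert e J) + s ((f(e := g)) ` (insert e I - insert e J))"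
      using f(3) by simp
    moreover have "\<forall>i\<in>insert e I. (f(e := g)) i \<in> A i" "insert e J \<subseteq> insert e I" using f g by auto
    ultimately show ?thesis by (intro exI conjI)
  next
    assume *: "\<forall>R\<subseteq>I. K < ?c R + r (\<Union>(A ` R)) + s (insert g (\<Union>(A ` R)))"
    have "\<exists>f J. (\<forall>i\<in>I. f i \<in> A i) \<and> J \<subseteq> I \<and> K \<le> r (f ` J) + s (insert g (f ` (I - J)))"
    proof (rule insert.IH)
      fix R assume R: "R \<subseteq> I"
      show "K \<le> int (card (I - R)) + r (\<Union>(A ` R)) + s (insert g (\<Union>(A ` R)))"
        using *[rule_format, OF R] c[OF R] by linarith
    qed (use insert.prems(1-3) r s polymatroid_on_insert[OF r gP] polymatroid_on_insert[OF s gP] in auto)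
    then obtain f J where f: "\<forall>i\<in>I. f i \<in> A i" "J \<subseteq> I" "K \<le> r (f ` J) + s (insert g (f ` (I - J)))"
      by blast
    have "insert e I - J = insert e (I - J)" using insert.hyps f(2) by auto
    moreover have "(f(e := g)) ` (I - J) = f ` (I - J)" by (rule img) auto
    ultimately have "K \<le> r ((f(e := g)) ` J) + s ((f(e := g)) ` (insert e I - J))"
      using f(3) img[OF f(2), of f] by (simp del: fun_upd_apply add: fun_upd_same)
    moreover have "\<forall>i\<in>insert e I. (f(e := g)) i \<in> A i" "J \<subseteq> insert e I" using f g by auto
    ultimately show ?thesis by (intro exI conjI)
  qed
qed

section \<open>The graphic rank function\<close>

text \<open>Pairs stand for undirected edges. The relation is reflexive on the whole type, so a
  vertex that meets no pair forms a class of its own.\<close>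

definition conn :: "('a \<times> 'a) set \<Rightarrow> ('a \<times> 'a) set" where
  "conn X = (X \<union> X\<inverse>)\<^sup>*"

definition ncomp :: "'a set \<Rightarrow> ('a \<times> 'a) set \<Rightarrow> nat" where
  "ncomp V X = card ((\<lambda>v. conn X `` {v}) ` V)"

text \<open>The rank function of the cycle matroid: for \<open>X \<subseteq> V \<times> V\<close> it
  is the number of edges of a spanning forest.\<close>

definition graphic_rank :: "'a set \<Rightarrow> ('a \<times> 'a) set \<Rightarrow> int" where
  "graphic_rank V X = int (card V) - int (ncomp V X)"

lemma equiv_conn: "equiv UNIV (conn X)"
  unfolding conn_def
  by (intro equivI refl_rtrancl trans_rtrancl sym_rtrancl) (auto simp: sym_def)

lemma conn_mono: "X \<subseteq> Y \<Longrightarrow> conn X \<subseteq> conn Y"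
  unfolding conn_def by (intro rtrancl_mono) auto

lemma conn_refl [simp]: "(a, a) \<in> conn X"
  by (simp add: conn_def)

lemma conn_sym: "(a, b) \<in> conn X \<Longrightarrow> (b, a) \<in> conn X"
  using equiv_conn by (metis equivE symD)

lemma conn_trans: "(a, b) \<in> conn X \<Longrightarrow> (b, c) \<in> conn X \<Longrightarrow> (a, c) \<in> conn X"
  using equiv_conn by (metis equivE transD)

lemma conn_edge: "(a, b) \<in> X \<Longrightarrow> (a, b) \<in> conn X"
  unfolding conn_def by auto

lemma conn_class_eq_iff: "conn X `` {a} = conn X `` {b} \<longleftrightarrow> (a, b) \<in> conn X"
  using eq_equiv_class_iff[OF equiv_conn, of a b X] by simp

text \<open>A path can be shortened until it uses the new edge at most once, in one of the two
  directions.\<close>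

lemma conn_insertD:
  assumes "(u, v) \<in> conn (insert (a, b) X)"
  shows "(u, v) \<in> conn X \<or> (u, a) \<in> conn X \<and> (b, v) \<in> conn X \<or> (u, b) \<in> conn X \<and> (a, v) \<in> conn X"
proof -
  have "(u, v) \<in> (insert (a, b) X \<union> (insert (a, b) X)\<inverse>)\<^sup>*" using assms by (simp add: conn_def)
  then show ?thesis
  proof induction
    case base
    then show ?case by simp
  next
    case (step y z)
    from step.hyps(2) consider "(y, z) \<in> X \<union> X\<inverse>" | "y = a" "z = b" | "y = b" "z = a" by auto
    then show ?case
    proof cases
      case 1
      then have "(y, z) \<in> conn X" by (auto intro: conn_edge conn_sym)
      then have "(w, z) \<in> conn X" if "(w, y) \<in> conn X" for w using that conn_trans by metis
      then show ?thesis using step.IH by blast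
    next
      case 2
      then show ?thesis using step.IH by auto
    next
      case 3
      then show ?thesis using step.IH by auto
    qed
  qed
qed

lemma conn_insert_class:
  "conn (insert (a, b) X) `` {v} =
    (if v \<in> conn X `` {a} \<union> conn X `` {b} then conn X `` {a} \<union> conn X `` {b} else conn X `` {v})"
    (is "_ = ?R")
proof -
  let ?Y = "insert (a, b) X"
  have lift: "(u, w) \<in> conn ?Y" if "(u, w) \<in> conn X" for u w
    using that conn_mono[of X ?Y] by auto
  have ab: "(a, b) \<in> conn ?Y" "(b, a) \<in> conn ?Y" using conn_edge[of a b ?Y] conn_sym by auto
  have "w \<in> ?R" if "(v, w) \<in> conn ?Y" for w
    using conn_insertD[OF that]
  proof (elim disjE conjE)
    assume "(v, w) \<in> conn X"
    then show ?thesis using conn_trans[of a v X w] conn_trans[of b v X w] by auto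
  next
    assume "(v, a) \<in> conn X" "(b, w) \<in> conn X"
    then show ?thesis using conn_sym[of v a X] by auto
  next
    assume "(v, b) \<in> conn X" "(a, w) \<in> conn X"
    then show ?thesis using conn_sym[of v b X] by auto
  qed
  moreover have "(v, w) \<in> conn ?Y" if "w \<in> ?R" for w
  proof (cases "v \<in> conn X `` {a} \<union> conn X `` {b}")
    case True
    have "(a, u) \<in> conn ?Y" if "u \<in> conn X `` {a} \<union> conn X `` {b}" for u
      using that lift[of a u] lift[of b u] conn_trans[OF ab(1), of u] by auto
    then show ?thesis using that True conn_sym[of a v ?Y] conn_trans[of v a ?Y w] by auto
  qed (use that lift in auto)
  ultimately show ?thesis by blast
qed

text \<open>The new edge merges the classes of its two ends and leaves all others alone. The second
  claim makes the truncated subtraction in the first a genuine one.\<close>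

lemma ncomp_insert:
  assumes "finite V" "a \<in> V" "b \<in> V"
  shows "ncomp V (insert (a, b) X) = (if (a, b) \<in> conn X then ncomp V X else ncomp V X - 1)"
    and "(a, b) \<notin> conn X \<Longrightarrow> ncomp V X \<ge> 1"
proof -
  let ?C = "\<lambda>v. conn X `` {v}"
  show ge: "ncomp V X \<ge> 1" if "(a, b) \<notin> conn X"
    using assms card_gt_0_iff[of "?C ` V"] by (fastforce simp: ncomp_def)
  show "ncomp V (insert (a, b) X) = (if (a, b) \<in> conn X then ncomp V X else ncomp V X - 1)"
  proof (cases "(a, b) \<in> conn X")
    case True
    then have ab: "?C b = ?C a" by (simp add: conn_class_eq_iff conn_sym)
    have "?C a = ?C v" if "v \<in> ?C a" for v using that conn_class_eq_iff[of X a v] by blast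
    then have "conn (insert (a, b) X) `` {v} = ?C v" for v
      unfolding conn_insert_class ab by (metis Un_absorb)
    then show ?thesis using True by (simp add: ncomp_def)
  next
    case False
    then have ne: "?C a \<noteq> ?C b" by (simp add: conn_class_eq_iff)
    let ?U = "?C a \<union> ?C b"
    have "(\<lambda>v. conn (insert (a, b) X) `` {v}) ` V = insert ?U (?C ` V - {?C a, ?C b})" (is "?L = ?R")
    proof
      show "?L \<subseteq> ?R"
      proof
        fix D assume "D \<in> ?L"
        then obtain v where v: "v \<in> V" "D = conn (insert (a, b) X) `` {v}" by blast
        show "D \<in> ?R"
        proof (cases "v \<in> ?U")
          case True
          then show ?thesis using v(2) by (simp add: conn_insert_class)
        next
          case False
          have "v \<in> ?C v" by simp
          with False have "?C v \<noteq> ?C a" "?C v \<noteq> ?C b" by blast+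
          then show ?thesis using False v by (simp add: conn_insert_class)
        qed
      qed
      show "?R \<subseteq> ?L"
      proof
        fix D assume "D \<in> ?R"
        then consider "D = ?U" | v where "v \<in> V" "D = ?C v" "D \<noteq> ?C a" "D \<noteq> ?C b" by auto
        then show "D \<in> ?L"
        proof cases
          case 1
          then show ?thesis using assms by (intro image_eqI[of _ _ a]) (auto simp: conn_insert_class)
        next
          case 2
          then have "v \<notin> ?U"
            using conn_class_eq_iff[of X a v] conn_class_eq_iff[of X b v] by auto
          then show ?thesis using 2 by (intro image_eqI[of _ _ v]) (auto simp: conn_insert_class)
        qed
      qed
    qed
    moreover have "?U \<notin> ?C ` V - {?C a, ?C b}"
    proof
      assume "?U \<in> ?C ` V - {?C a, ?C b}"
      then obtain v where v: "?C v = ?U" "?C v \<noteq> ?C a" by auto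
      have "a \<in> ?C v" unfolding v(1) by simp
      then have "(v, a) \<in> conn X" by simp
      with v(2) show False using conn_class_eq_iff[of X v a] by blast
    qed
    moreover have "card (?C ` V - {?C a, ?C b}) = ncomp V X - 2"
      using ne assms by (subst card_Diff_subset) (auto simp: ncomp_def)
    \<comment> \<open>There are at least two classes, so \<open>ncomp V X - 2\<close> is not
      truncated; removing two classes and adding their union lowers the number by one.\<close>
    moreover have "card {?C a, ?C b} \<le> ncomp V X"
      unfolding ncomp_def using assms by (intro card_mono) auto
    ultimately show ?thesis using ne False assms by (simp add: ncomp_def)
  qed
qed

text \<open>Marginal gains that shrink for single elements also shrink for whole sets
  \<open>Z\<close>, by induction on \<open>Z\<close>. Submodularity is the case of adding
  \<open>Y\<close> to \<open>X \<inter> Y\<close> and to \<open>X\<close>.\<close>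

lemma polymatroid_onI_diminishing:
  fixes r :: "'b set \<Rightarrow> int"
  assumes "finite P"
    and mono: "\<And>X g. X \<subseteq> P \<Longrightarrow> g \<in> P \<Longrightarrow> r X \<le> r (insert g X)"
    and dim: "\<And>X Y g. X \<subseteq> Y \<Longrightarrow> Y \<subseteq> P \<Longrightarrow> g \<in> P \<Longrightarrow> r (insert g Y) - r Y \<le> r (insert g X) - r X"
  shows "polymatroid_on P r"
proof -
  have mono': "r X \<le> r (X \<union> Z)" if "X \<subseteq> P" "Z \<subseteq> P" for X Z
  proof -
    have "finite Z" using that assms(1) finite_subset by blast
    then show ?thesis using that(2)
    proof (induction Z)
      case (insert g Z)
      then show ?case using mono[of "X \<union> Z" g] that(1) by simp
    qed simp
  qed
  have dim': "r (Y \<union> Z) - r Y \<le> r (X \<union> Z) - r X" if "X \<subseteq> Y" "Y \<subseteq> P" "Z \<subseteq> P" for X Y Z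
  proof -
    have "finite Z" using that assms(1) finite_subset by blast
    then show ?thesis using that(3)
    proof (induction Z)
      case (insert g Z)
      then show ?case using dim[of "X \<union> Z" "Y \<union> Z" g] that by fastforce
    qed simp
  qed
  show ?thesis unfolding polymatroid_on_def
  proof (intro conjI allI impI)
    fix X Y :: "'b set" assume "X \<subseteq> Y" "Y \<subseteq> P"
    then show "r X \<le> r Y" using mono'[of X Y] by (simp add: Un_absorb1)
  next
    fix X Y :: "'b set" assume "X \<subseteq> P" "Y \<subseteq> P"
    then show "r (X \<union> Y) + r (X \<inter> Y) \<le> r X + r Y"
      using dim'[of "X \<inter> Y" X Y] by (simp add: Un_absorb1)
  qed
qed

text \<open>The marginal gain of a pair is 0 or 1 according to whether its ends are already
  connected, and a larger set of pairs connects more.\<close>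

lemma polymatroid_on_graphic_rank:
  assumes "finite V"
  shows "polymatroid_on (V \<times> V) (graphic_rank V)"
proof (rule polymatroid_onI_diminishing)
  have ins: "graphic_rank V (insert g X) - graphic_rank V X = (if g \<in> conn X then 0 else 1)"
    if "g \<in> V \<times> V" for g X
    using that ncomp_insert[OF assms, of "fst g" "snd g" X] by (auto simp: graphic_rank_def)
  fix X Y :: "('a \<times> 'a) set" and g
  { assume "X \<subseteq> V \<times> V" "g \<in> V \<times> V"
    then show "graphic_rank V X \<le> graphic_rank V (insert g X)" using ins[of g X] by (auto split: if_splits)
  next
    assume "X \<subseteq> Y" "Y \<subseteq> V \<times> V" "g \<in> V \<times> V"
    then show "graphic_rank V (insert g Y) - graphic_rank V Y \<le> graphic_rank V (insert g X) - graphic_rank V X"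
      using conn_mono[of X Y] by (auto simp: ins) }
qed (use assms in auto)

lemma graphic_rank_le:
  assumes "finite V" "V \<noteq> {}"
  shows "graphic_rank V X \<le> int (card V) - 1"
  using assms card_gt_0_iff[of "(\<lambda>v. conn X `` {v}) ` V"] by (simp add: graphic_rank_def ncomp_def)

lemma connected_if_graphic_rank:
  assumes "finite V" "graphic_rank V X \<ge> int (card V) - 1" "u \<in> V" "v \<in> V"
  shows "(u, v) \<in> conn X"
proof -
  have "card ((\<lambda>v. conn X `` {v}) ` V) \<le> Suc 0" using assms(2) by (simp add: graphic_rank_def ncomp_def)
  then have "conn X `` {u} = conn X `` {v}" using assms by (meson card_le_Suc0_iff_eq finite_imageI imageI)
  then show ?thesis by (simp add: conn_class_eq_iff)
qed

section \<open>Prescribing parities\<close>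

lemma card_fiber_remove:
  assumes "finite J" "i \<in> J"
  shows "card {j \<in> J. s j = v} = card {j \<in> J - {i}. s j = v} + (if s i = v then 1 else 0)"
proof (cases "s i = v")
  case True
  then have "{j \<in> J. s j = v} = insert i {j \<in> J - {i}. s j = v}" using assms by auto
  then show ?thesis using True assms by simp
next
  case False
  then have "{j \<in> J. s j = v} = {j \<in> J - {i}. s j = v}" by auto
  then show ?thesis using False by simp
qed

text \<open>Switching the choices along a path from \<open>u\<close> to \<open>w\<close> changes the
  parity twice at every inner vertex. The nested equivalence says that parities flip exactly at
  \<open>u\<close> and \<open>w\<close>, and nowhere if \<open>u = w\<close>.\<close>

lemma flip_choice:
  assumes "finite J" and ne: "\<And>i. i \<in> J \<Longrightarrow> fst (g i) \<noteq> snd (g i)"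
    and s: "\<forall>i\<in>J. s i \<in> {fst (g i), snd (g i)}"
    and uw: "(u, w) \<in> conn (g ` J)"
  shows "\<exists>s'. (\<forall>i\<in>J. s' i \<in> {fst (g i), snd (g i)}) \<and>
    (\<forall>v. even (card {i \<in> J. s' i = v}) \<longleftrightarrow> (even (card {i \<in> J. s i = v}) \<longleftrightarrow> (v = u \<longleftrightarrow> v = w)))"
  using uw unfolding conn_def
proof induction
  case base
  then show ?case using s by auto
next
  case (step y z)
  then obtain s' where s': "\<forall>i\<in>J. s' i \<in> {fst (g i), snd (g i)}"
    "\<And>v. even (card {i \<in> J. s' i = v}) \<longleftrightarrow> (even (card {i \<in> J. s i = v}) \<longleftrightarrow> (v = u \<longleftrightarrow> v = y))"
    by blast
  from step.hyps(2) obtain i where i: "i \<in> J" "g i = (y, z) \<or> g i = (z, y)" by fastforce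
  have yz: "y \<noteq> z" using ne[OF i(1)] i(2) by auto
  \<comment> \<open>The chosen end of edge \<open>i\<close> is exchanged for its other end, which
    flips the parities of \<open>y\<close> and \<open>z\<close> only.\<close>
  define s'' where "s'' = s'(i := if s' i = y then z else y)"
  have s'i: "s' i = y \<or> s' i = z" using s'(1) i by auto
  have "even (card {j \<in> J. s'' j = v}) \<longleftrightarrow> (even (card {j \<in> J. s j = v}) \<longleftrightarrow> (v = u \<longleftrightarrow> v = z))" for v
  proof -
    have "{j \<in> J - {i}. s'' j = v} = {j \<in> J - {i}. s' j = v}" by (auto simp: s''_def)
    then have "even (card {j \<in> J. s'' j = v}) \<longleftrightarrow> (even (card {j \<in> J. s' j = v}) \<longleftrightarrow> (v = y \<longleftrightarrow> v = z))"
      using card_fiber_remove[OF assms(1) i(1), of s' v] card_fiber_remove[OF assms(1) i(1), of s'' v]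
        s'i yz by (auto simp: s''_def)
    then show ?thesis unfolding s'(2) by blast
  qed
  moreover have "\<forall>j\<in>J. s'' j \<in> {fst (g j), snd (g j)}" using s'(1) i by (auto simp: s''_def)
  ultimately show ?case by blast
qed

text \<open>A T-join argument: take a choice with the fewest odd vertices. Their number is even, so
  if one is left there is a second, and flipping along a path between them removes both.\<close>

lemma parity_choice:
  assumes "finite V" "finite J" and ne: "\<And>i. i \<in> J \<Longrightarrow> fst (g i) \<noteq> snd (g i)"
    and V: "\<And>i. i \<in> J \<Longrightarrow> g i \<in> V \<times> V"
    and connected: "\<And>u w. u \<in> V \<Longrightarrow> w \<in> V \<Longrightarrow> (u, w) \<in> conn (g ` J)"
    and total: "even ((\<Sum>v\<in>V. t v) + card J)"
  shows "\<exists>s. (\<forall>i\<in>J. s i \<in> {fst (g i), snd (g i)}) \<and> (\<forall>v\<in>V. even (t v + card {i \<in> J. s i = v}))"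
proof -
  let ?ok = "\<lambda>s. \<forall>i\<in>J. s i \<in> {fst (g i), snd (g i)}"
  let ?c = "\<lambda>s v. t v + card {i \<in> J. s i = v}"
  let ?O = "\<lambda>s. {v \<in> V. odd (?c s v)}"
  have "?ok (\<lambda>i. fst (g i))" by simp
  then obtain s where s: "?ok s" and min: "\<And>s'. ?ok s' \<Longrightarrow> card (?O s) \<le> card (?O s')"
    using ex_has_least_nat[of ?ok "\<lambda>i. fst (g i)" "\<lambda>s. card (?O s)"] by auto
  have "?O s = {}"
  proof (rule ccontr)
    assume "?O s \<noteq> {}"
    then obtain u where u: "u \<in> ?O s" by blast
    \<comment> \<open>Each index selects exactly one vertex of \<open>V\<close>; hence the sum of
      all counts has the parity fixed by \<open>total\<close>, whatever the choice.\<close>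
    have "(\<Sum>v\<in>V. card {i \<in> J. s i = v}) = card J"
    proof -
      have "s i \<in> V" if "i \<in> J" for i using s V[OF that] that by (metis insertE mem_Times_iff singletonD)
      then have "J = (\<Union>v\<in>V. {i \<in> J. s i = v})" by auto
      also have "card \<dots> = (\<Sum>v\<in>V. card {i \<in> J. s i = v})"
        using assms(1,2) by (intro card_UN_disjoint) auto
      finally show ?thesis by simp
    qed
    then have "even (\<Sum>v\<in>V. ?c s v)" using total by (simp add: sum.distrib)
    then have "even (card (?O s))" using even_sum_iff[OF assms(1), of "?c s"] by simp
    then have "?O s \<noteq> {u}" by auto
    then obtain w where w: "w \<in> ?O s" "w \<noteq> u" using u by blast
    have "(u, w) \<in> conn (g ` J)" using u w by (intro connected) auto
    from flip_choice[OF assms(2) ne s this] obtain s' where s': "?ok s'"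
      "\<And>v. even (card {i \<in> J. s' i = v}) \<longleftrightarrow> (even (card {i \<in> J. s i = v}) \<longleftrightarrow> (v = u \<longleftrightarrow> v = w))"
      by blast
    have "?O s' \<subset> ?O s" using u w by (auto simp: s'(2))
    then have "card (?O s') < card (?O s)" using assms(1) by (intro psubset_card_mono) auto
    with min[OF s'(1)] show False by simp
  qed
  with s show ?thesis by blast
qed

section \<open>Euler circuits\<close>

text \<open>An entry \<open>(a, i)\<close> means leaving \<open>a\<close> along the edge with index
  \<open>i\<close>, in either direction. Using indices keeps parallel edges apart. Only the vertices
  that are left are listed, so the final vertex has no entry of its own.\<close>

fun trail :: "('i \<Rightarrow> 'a \<times> 'a) \<Rightarrow> 'a \<Rightarrow> ('a \<times> 'i) list \<Rightarrow> 'a \<Rightarrow> bool" where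
  "trail e u [] w \<longleftrightarrow> u = w"
| "trail e u ((a, i) # p) w \<longleftrightarrow> a = u \<and> (\<exists>b. (e i = (a, b) \<or> e i = (b, a)) \<and> trail e b p w)"

definition ends :: "('i \<Rightarrow> 'a \<times> 'a) \<Rightarrow> 'i \<Rightarrow> 'a set" where
  "ends e i = {fst (e i), snd (e i)}"

lemma trail_append: "trail e u (p @ q) w \<longleftrightarrow> (\<exists>v. trail e u p v \<and> trail e v q w)"
  by (induction e u p w rule: trail.induct) auto

lemma trail_ends:
  assumes "trail e u p w" "i \<in> snd ` set p"
  shows "ends e i \<subseteq> insert w (fst ` set p)"
  using assms
proof (induction p arbitrary: u)
  case (Cons d p)
  obtain a j where d: "d = (a, j)" by (cases d)
  from Cons.prems d obtain b where b: "a = u" "e j = (a, b) \<or> e j = (b, a)" "trail e b p w" by auto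
  have "b \<in> insert w (fst ` set p)" using b(3) by (cases p) auto
  moreover have "ends e j = {a, b}" using b(2) by (auto simp: ends_def)
  ultimately have "ends e j \<subseteq> insert w (fst ` set (d # p))" by (simp add: d insert_commute)
  moreover have "ends e i \<subseteq> insert w (fst ` set p)" if "i \<in> snd ` set p"
    using Cons.IH[OF b(3) that] .
  ultimately show ?case using Cons.prems(2) d by auto
qed auto

text \<open>Each passage through \<open>v\<close> uses two edges at \<open>v\<close>; only the start
  and the end of the trail contribute a single one, and they cancel when they coincide.\<close>

lemma trail_parity:
  assumes "trail e u p w" "\<And>i. i \<in> snd ` set p \<Longrightarrow> fst (e i) \<noteq> snd (e i)"
  shows "even (length (filter (\<lambda>i. v \<in> ends e i) (map snd p))) \<longleftrightarrow> (v = u \<longleftrightarrow> v = w)"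
  using assms
proof (induction p arbitrary: u)
  case (Cons d p)
  obtain a j where d: "d = (a, j)" by (cases d)
  from Cons.prems d obtain b where b: "a = u" "e j = (a, b) \<or> e j = (b, a)" "trail e b p w" by auto
  have "a \<noteq> b" using Cons.prems(2)[of j] b d by auto
  moreover have "v \<in> ends e j \<longleftrightarrow> v = a \<or> v = b" using b by (auto simp: ends_def)
  ultimately show ?case using Cons.IH[OF b(3)] Cons.prems(2) b(1) by (auto simp: d)
qed auto

lemma trail_nth:
  assumes "trail e u p w" "k < length p"
  shows "ends e (snd (p ! k)) = {fst (p ! k), if Suc k < length p then fst (p ! Suc k) else w}"
  using assms
proof (induction p arbitrary: u k)
  case (Cons d p)
  obtain a j where d: "d = (a, j)" by (cases d)
  from Cons.prems d obtain b where b: "a = u" "e j = (a, b) \<or> e j = (b, a)" "trail e b p w" by auto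
  show ?case
  proof (cases k)
    case 0
    have "b = (if p = [] then w else fst (p ! 0))" using b(3) by (cases p) auto
    then show ?thesis using 0 b(2) by (auto simp: d ends_def)
  next
    case (Suc l)
    then show ?thesis using Cons.IH[OF b(3), of l] Cons.prems(2) by simp
  qed
qed auto

text \<open>A longest trail without repeated edges is closed, because degrees are even. If it missed
  an edge, connectivity would give a missed edge touching it; rotating the trail to start there and
  appending that edge would make it longer.\<close>

lemma euler_circuit:
  assumes "finite I" and ne: "\<And>i. i \<in> I \<Longrightarrow> fst (e i) \<noteq> snd (e i)"
    and even: "\<And>v. even (card {i \<in> I. v \<in> ends e i})"
    and connected: "\<And>i j. i \<in> I \<Longrightarrow> j \<in> I \<Longrightarrow> (fst (e i), fst (e j)) \<in> conn (e ` I)"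
  shows "\<exists>u p. trail e u p u \<and> distinct (map snd p) \<and> snd ` set p = I"
proof -
  let ?P = "\<lambda>p. (\<exists>u w. trail e u p w) \<and> distinct (map snd p) \<and> snd ` set p \<subseteq> I"
  have "?P []" by auto
  moreover have "length p < Suc (card I)" if "?P p" for p
  proof -
    have "length p = card (snd ` set p)" using that distinct_card[of "map snd p"] by simp
    then show ?thesis using that card_mono[OF assms(1)] by (metis less_Suc_eq_le)
  qed
  ultimately have "\<exists>p. ?P p \<and> (\<forall>q. ?P q \<longrightarrow> length q \<le> length p)"
    by (intro ex_has_greatest_nat[of ?P "[]" length "Suc (card I)"]) simp_all
  then obtain p where max: "?P p \<and> (\<forall>q. ?P q \<longrightarrow> length q \<le> length p)" ..
  then have p: "?P p" by (rule conjunct1)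
  have longest: "length q \<le> length p" if "?P q" for q
    using conjunct2[OF max] that by (elim allE[of _ q] mp)
  from p obtain u w where tr: "trail e u p w" by blast
  have extend: "?P (q @ [(v, i)])"
    if "trail e u' q v" "distinct (map snd q)" "snd ` set q \<subseteq> I" "i \<in> I - snd ` set q" "v \<in> ends e i"
    for u' q v i
  proof -
    have "\<exists>w. trail e v [(v, i)] w" using that(5) by (cases "e i") (auto simp: ends_def)
    then show ?thesis using that by (auto simp: trail_append)
  qed
  have uw: "u = w"
  proof (rule ccontr)
    assume "u \<noteq> w"
    then have "odd (length (filter (\<lambda>i. w \<in> ends e i) (map snd p)))"
      using trail_parity[OF tr, of w] ne p by auto
    also have "length (filter (\<lambda>i. w \<in> ends e i) (map snd p)) = card {i \<in> snd ` set p. w \<in> ends e i}"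
      using p distinct_card[of "filter (\<lambda>i. w \<in> ends e i) (map snd p)"]
      by (simp add: distinct_filter)
    finally have "{i \<in> snd ` set p. w \<in> ends e i} \<noteq> {i \<in> I. w \<in> ends e i}" using even[of w] by metis
    then obtain i where "i \<in> I - snd ` set p" "w \<in> ends e i" using p by blast
    with extend[OF tr] p longest[of "p @ [(w, i)]"] show False by auto
  qed
  have "snd ` set p = I"
  proof (rule ccontr)
    assume "snd ` set p \<noteq> I"
    then obtain i where i: "i \<in> I" "i \<notin> snd ` set p" using p by blast
    have "p \<noteq> []"
    proof
      assume "p = []"
      with extend[of "fst (e i)" "[]" "fst (e i)" i] i longest[of "[(fst (e i), i)]"]
      show False by (auto simp: ends_def)
    qed
    define d where "d = hd p"
    have d: "d \<in> set p" "fst d = u" using tr \<open>p \<noteq> []\<close> by (cases p; auto simp: d_def)+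
    then have u: "u \<in> fst ` set p" by auto
    have "snd d \<in> I" using d p by auto
    have "u \<in> ends e (snd d)"
      using d(1) trail_nth[OF tr] d(2) by (metis in_set_conv_nth insertI1)
    then have "(fst (e (snd d)), u) \<in> conn (e ` I)"
      using \<open>snd d \<in> I\<close> conn_edge[of "fst (e (snd d))" "snd (e (snd d))" "e ` I"] by (auto simp: ends_def)
    then have "(u, fst (e i)) \<in> conn (e ` I)"
      by (rule conn_trans[OF conn_sym connected[OF \<open>snd d \<in> I\<close> i(1)]])
    \<comment> \<open>Follow a path from \<open>u\<close> to an end of the missed edge
      \<open>i\<close>: it either stays on visited vertices or leaves them along an edge outside the
      trail.\<close>
    then have "fst (e i) \<in> fst ` set p \<or> (\<exists>j\<in>I - snd ` set p. ends e j \<inter> fst ` set p \<noteq> {})"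
      unfolding conn_def
    proof induction
      case base
      then show ?case using u by simp
    next
      case (step y z)
      show ?case
      proof (cases "y \<in> fst ` set p")
        case True
        from step.hyps(2) obtain j where j: "j \<in> I" "e j = (y, z) \<or> e j = (z, y)" by fastforce
        then have "y \<in> ends e j" "z \<in> ends e j" by (auto simp: ends_def)
        moreover have "ends e j \<subseteq> fst ` set p" if "j \<in> snd ` set p"
          using trail_ends[OF tr that] u uw by (simp add: insert_absorb)
        ultimately show ?thesis using True j(1) by blast
      qed (use step.IH in blast)
    qed
    then obtain j z where j: "j \<in> I - snd ` set p" "z \<in> ends e j" "z \<in> fst ` set p"
      using i by (auto simp: ends_def)
    \<comment> \<open>The closed trail is cut at \<open>z\<close> and its two pieces are swapped, so
      that it starts and ends at \<open>z\<close>.\<close>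
    then obtain l p1 p2 where split: "p = p1 @ (z, l) # p2" by (metis imageE prod.collapse split_list)
    then have "trail e z ((z, l) # p2 @ p1) z"
      using tr uw by (auto simp: trail_append)
    moreover have "distinct (map snd ((z, l) # p2 @ p1))" "snd ` set ((z, l) # p2 @ p1) = snd ` set p"
      using p by (auto simp: split)
    ultimately have "?P (((z, l) # p2 @ p1) @ [(z, j)])"
      using j p by (intro extend) auto
    from longest[OF this] show False by (simp add: split)
  qed
  with tr uw p show ?thesis by blast
qed

section \<open>Choosing pairs in the edges of a hypergraph\<close>

text \<open>Every class other than that of \<open>u\<close> contains at least one vertex of
  \<open>V\<close>.\<close>

lemma card_inequivalent_ge:
  assumes "finite V" "u \<in> V"
  shows "ncomp V X - 1 \<le> card {v \<in> V. (u, v) \<notin> conn X}"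
proof -
  let ?C = "\<lambda>v. conn X `` {v}"
  have "?C ` V \<subseteq> insert (?C u) (?C ` {v \<in> V. (u, v) \<notin> conn X})"
  proof
    fix D assume "D \<in> ?C ` V"
    then obtain v where v: "v \<in> V" "D = ?C v" by blast
    then show "D \<in> insert (?C u) (?C ` {v \<in> V. (u, v) \<notin> conn X})"
      using conn_class_eq_iff[of X u v] by (cases "(u, v) \<in> conn X") (simp, blast)
  qed
  then have "ncomp V X \<le> card (insert (?C u) (?C ` {v \<in> V. (u, v) \<notin> conn X}))"
    unfolding ncomp_def using assms by (intro card_mono) auto
  also have "\<dots> \<le> Suc (card (?C ` {v \<in> V. (u, v) \<notin> conn X}))"
    by (rule card_insert_le_m1) auto
  also have "\<dots> \<le> Suc (card {v \<in> V. (u, v) \<notin> conn X})"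
    using assms by (auto intro: card_image_le)
  finally show ?thesis by simp
qed

text \<open>The transversal theorem with the graphic rank in both roles and
  \<open>K = 2 * (card V - 1)\<close>: this target is attainable only if both classes have full
  rank. The rank condition says that at least \<open>2 * (q - 1)\<close> edges remain outside
  \<open>R\<close> when the pairs inside \<open>R\<close> leave \<open>q\<close> components.\<close>

lemma two_disjoint_hypertrees:
  fixes h :: "'i \<Rightarrow> 'a set"
  assumes V: "finite V" "V \<noteq> {}" and "finite I" and k: "k \<ge> 2" "2 * (k - 1) \<le> card V"
    and h: "\<And>i. i \<in> I \<Longrightarrow> h i \<subseteq> V" "\<And>i. i \<in> I \<Longrightarrow> 2 \<le> card (h i)" "\<And>i. i \<in> I \<Longrightarrow> card (h i) \<le> k"
    and deg: "\<And>u v. u \<in> V \<Longrightarrow> v \<in> V \<Longrightarrow> u \<noteq> v \<Longrightarrow> k \<le> card {i \<in> I. u \<in> h i \<and> v \<in> h i}"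
  shows "\<exists>g J. (\<forall>i\<in>I. g i \<in> h i \<times> h i \<and> fst (g i) \<noteq> snd (g i)) \<and> J \<subseteq> I \<and>
    (\<forall>u\<in>V. \<forall>v\<in>V. (u, v) \<in> conn (g ` J) \<and> (u, v) \<in> conn (g ` (I - J)))"
proof -
  define A where "A = (\<lambda>i. SIGMA a:h i. h i - {a})"
  have fin: "finite (h i)" if "i \<in> I" for i using h(1)[OF that] V finite_subset by blast
  have finA: "finite (A i)" if "i \<in> I" for i using fin[OF that] by (auto simp: A_def)
  have cardA: "card (A i) \<le> k * (k - 1)" if "i \<in> I" for i
  proof -
    have "card (A i) = (\<Sum>a\<in>h i. card (h i - {a}))"
      unfolding A_def using fin[OF that] by (intro card_SigmaI) auto
    also have "\<dots> = card (h i) * (card (h i) - 1)" by simp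
    also have "\<dots> \<le> k * (k - 1)" using h(3)[OF that] by (intro mult_le_mono) auto
    finally show ?thesis .
  qed
  have AV: "A i \<subseteq> V \<times> V" if "i \<in> I" for i using h(1)[OF that] by (auto simp: A_def)
  have Ane: "A i \<noteq> {}" if "i \<in> I" for i
  proof -
    have "\<exists>a\<in>h i. \<exists>b\<in>h i. a \<noteq> b"
      using h(2)[OF that] card_le_Suc0_iff_eq[OF fin[OF that]] by fastforce
    then show ?thesis by (auto simp: A_def)
  qed
  let ?n = "card V" and ?r = "graphic_rank V"
  have n: "?n \<ge> 1" using V by (simp add: Suc_le_eq card_gt_0_iff)
  have "\<exists>g J. (\<forall>i\<in>I. g i \<in> A i) \<and> J \<subseteq> I \<and> 2 * int ?n - 2 \<le> ?r (g ` J) + ?r (g ` (I - J))"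
  proof (rule polymatroid_transversal_partition[OF \<open>finite I\<close> AV Ane finA])
    show "polymatroid_on (V \<times> V) ?r" "polymatroid_on (V \<times> V) ?r"
      using V by (auto intro: polymatroid_on_graphic_rank)
    fix R assume R: "R \<subseteq> I"
    define X where "X = \<Union>(A ` R)"
    \<comment> \<open>\<open>C\<close> consists of the edges that meet several components, so it
      avoids \<open>R\<close>; \<open>N\<close> consists of the ordered vertex pairs in different
      components.\<close>
    define C where "C = {i \<in> I. \<exists>u\<in>h i. \<exists>v\<in>h i. (u, v) \<notin> conn X}"
    define N where "N = {p \<in> V \<times> V. p \<notin> conn X}"
    let ?q = "ncomp V X"
    have q: "?q \<ge> 1" using V by (auto simp: ncomp_def Suc_le_eq card_gt_0_iff)
    have finC: "finite C" using assms(3) by (auto simp: C_def)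
    have finN: "finite N" using V by (auto simp: N_def)
    have "(u, v) \<in> conn X" if "i \<in> R" "u \<in> h i" "v \<in> h i" for i u v
    proof (cases "u = v")
      case False
      then show ?thesis using that by (intro conn_edge) (auto simp: X_def A_def)
    qed simp
    then have "C \<subseteq> I - R" unfolding C_def by blast
    then have CR: "card C \<le> card (I - R)" using assms(3) by (intro card_mono) auto
    have "?n * (?q - 1) \<le> (\<Sum>u\<in>V. card {v \<in> V. (u, v) \<notin> conn X})"
      using sum_mono[of V "\<lambda>_. ?q - 1"] card_inequivalent_ge[OF V(1)] by simp
    also have "\<dots> = card (SIGMA u:V. {v \<in> V. (u, v) \<notin> conn X})"
      using V by (intro card_SigmaI[symmetric]) auto
    also have "(SIGMA u:V. {v \<in> V. (u, v) \<notin> conn X}) = N" by (auto simp: N_def)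
    finally have N: "?n * (?q - 1) \<le> card N" .
    \<comment> \<open>Double counting of incidences between \<open>N\<close> and \<open>C\<close>:
      each pair of \<open>N\<close> lies in at least \<open>k\<close> edges, all of them in
      \<open>C\<close>, and each edge covers at most \<open>k * (k - 1)\<close> ordered
      pairs.\<close>
    have "k * card N \<le> (\<Sum>p\<in>N. card {i \<in> C. p \<in> A i})"
    proof -
      have "k \<le> card {i \<in> C. p \<in> A i}" if "p \<in> N" for p
      proof -
        obtain u v where p: "p = (u, v)" by (cases p)
        with that have uv: "u \<in> V" "v \<in> V" "(u, v) \<notin> conn X" by (auto simp: N_def)
        then have "u \<noteq> v" by auto
        then have "{i \<in> C. p \<in> A i} = {i \<in> I. u \<in> h i \<and> v \<in> h i}"
          using uv by (auto simp: C_def A_def p)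
        then show ?thesis using deg uv \<open>u \<noteq> v\<close> by simp
      qed
      then show ?thesis using sum_mono[of N "\<lambda>_. k"] by (simp add: mult.commute)
    qed
    also have "\<dots> = (\<Sum>i\<in>C. card {p \<in> N. p \<in> A i})"
      using finC finN by (intro sum_multicount_gen) auto
    also have "\<dots> \<le> (\<Sum>i\<in>C. k * (k - 1))"
    proof (rule sum_mono)
      fix i assume "i \<in> C"
      then have i: "i \<in> I" by (simp add: C_def)
      have "card {p \<in> N. p \<in> A i} \<le> card (A i)" using finA[OF i] by (intro card_mono) auto
      then show "card {p \<in> N. p \<in> A i} \<le> k * (k - 1)" using cardA[OF i] by simp
    qed
    finally have "k * card N \<le> k * (card C * (k - 1))" by (simp add: mult.left_commute)
    then have "card N \<le> card C * (k - 1)" using k by simp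
    moreover have "(2 * (?q - 1)) * (k - 1) \<le> ?n * (?q - 1)"
      using k(2) mult_le_mono1[of "2 * (k - 1)" ?n "?q - 1"] by (simp add: mult_ac)
    ultimately have "(2 * (?q - 1)) * (k - 1) \<le> card C * (k - 1)" using N by linarith
    then have "2 * (?q - 1) \<le> card (I - R)" using k CR by simp
    then have "2 * ?q \<le> card (I - R) + 2" by arith
    then have "2 * int ?q \<le> int (card (I - R)) + 2" by linarith
    then show "2 * int ?n - 2 \<le> int (card (I - R)) + ?r (\<Union>(A ` R)) + ?r (\<Union>(A ` R))"
      unfolding X_def[symmetric] graphic_rank_def by (simp add: algebra_simps)
  qed
  then obtain g J where g: "\<forall>i\<in>I. g i \<in> A i" "J \<subseteq> I"
    "2 * int ?n - 2 \<le> ?r (g ` J) + ?r (g ` (I - J))" by blast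
  then have "?r (g ` J) \<ge> int ?n - 1" "?r (g ` (I - J)) \<ge> int ?n - 1"
    using graphic_rank_le[OF V, of "g ` J"] graphic_rank_le[OF V, of "g ` (I - J)"] by auto
  then have "\<forall>u\<in>V. \<forall>v\<in>V. (u, v) \<in> conn (g ` J) \<and> (u, v) \<in> conn (g ` (I - J))"
    using connected_if_graphic_rank[OF V(1)] by blast
  moreover have "\<forall>i\<in>I. g i \<in> h i \<times> h i \<and> fst (g i) \<noteq> snd (g i)"
    using g(1) by (fastforce simp: A_def)
  ultimately show ?thesis using g(2) by blast
qed

text \<open>The pairs of \<open>J\<close> guarantee connectivity and stay fixed. The pairs outside
  \<open>J\<close> serve as an auxiliary connected graph along which parities are moved; the edges
  there finally receive \<open>(x i, s i)\<close>.\<close>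

lemma even_connected_representatives:
  fixes h :: "'i \<Rightarrow> 'a set"
  assumes V: "finite V" "V \<noteq> {}" and "finite I" and k: "k \<ge> 2" "2 * (k - 1) \<le> card V"
    and h: "\<And>i. i \<in> I \<Longrightarrow> h i \<subseteq> V" "\<And>i. i \<in> I \<Longrightarrow> 3 \<le> card (h i)" "\<And>i. i \<in> I \<Longrightarrow> card (h i) \<le> k"
    and deg: "\<And>u v. u \<in> V \<Longrightarrow> v \<in> V \<Longrightarrow> u \<noteq> v \<Longrightarrow> k \<le> card {i \<in> I. u \<in> h i \<and> v \<in> h i}"
  shows "\<exists>e. (\<forall>i\<in>I. e i \<in> h i \<times> h i \<and> fst (e i) \<noteq> snd (e i)) \<and>
    (\<forall>v. even (card {i \<in> I. v \<in> ends e i})) \<and> (\<forall>u\<in>V. \<forall>v\<in>V. (u, v) \<in> conn (e ` I))"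
proof -
  obtain g J where g: "\<And>i. i \<in> I \<Longrightarrow> g i \<in> h i \<times> h i" "\<And>i. i \<in> I \<Longrightarrow> fst (g i) \<noteq> snd (g i)"
    and J: "J \<subseteq> I" and con: "\<And>u v. u \<in> V \<Longrightarrow> v \<in> V \<Longrightarrow> (u, v) \<in> conn (g ` J)"
      "\<And>u v. u \<in> V \<Longrightarrow> v \<in> V \<Longrightarrow> (u, v) \<in> conn (g ` (I - J))"
  proof -
    have "2 \<le> card (h i)" if "i \<in> I" for i using h(2)[OF that] by simp
    from two_disjoint_hypertrees[OF V \<open>finite I\<close> k h(1) this h(3) deg] that show ?thesis by blast
  qed
  let ?J = "I - J"
  have finJ: "finite J" using J \<open>finite I\<close> by (rule finite_subset)
  have "\<exists>x. x \<in> h i \<and> x \<notin> ends g i" if "i \<in> I" for i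
  proof (rule ccontr)
    assume "\<not> ?thesis"
    then have "card (h i) \<le> card (ends g i)" by (intro card_mono) (auto simp: ends_def)
    also have "\<dots> \<le> 2" by (simp add: ends_def card_insert_if)
    finally show False using h(2)[OF that] by simp
  qed
  then obtain x where x: "\<And>i. i \<in> I \<Longrightarrow> x i \<in> h i" "\<And>i. i \<in> I \<Longrightarrow> x i \<notin> ends g i" by metis
  \<comment> \<open>The degree contributed before \<open>s\<close> is chosen: both ends of each kept
    pair, and the third vertex \<open>x i\<close> of each remaining edge.\<close>
  define t where "t = (\<lambda>v. card {i \<in> J. v \<in> ends g i} + card {i \<in> ?J. x i = v})"
  have "\<exists>s. (\<forall>i\<in>?J. s i \<in> {fst (g i), snd (g i)}) \<and> (\<forall>v\<in>V. even (t v + card {i \<in> ?J. s i = v}))"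
  proof (rule parity_choice)
    have "(\<Sum>v\<in>V. card {i \<in> J. v \<in> ends g i}) = (\<Sum>i\<in>J. 2)"
    proof (rule sum_multicount_gen)
      show "\<forall>i\<in>J. card {v \<in> V. v \<in> ends g i} = 2"
      proof
        fix i assume "i \<in> J"
        then have i: "i \<in> I" using J by blast
        then have "{v \<in> V. v \<in> ends g i} = {fst (g i), snd (g i)}"
          using g(1)[OF i] h(1)[OF i] by (auto simp: ends_def mem_Times_iff)
        then show "card {v \<in> V. v \<in> ends g i} = 2" using g(2)[OF i] by simp
      qed
    qed (use V finJ in auto)
    moreover have "(\<Sum>v\<in>V. card {i \<in> ?J. x i = v}) = (\<Sum>i\<in>?J. 1)"
    proof (rule sum_multicount_gen)
      show "\<forall>i\<in>?J. card {v \<in> V. x i = v} = 1"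
      proof
        fix i assume "i \<in> ?J"
        then have "{v \<in> V. x i = v} = {x i}" using x(1)[of i] h(1)[of i] by auto
        then show "card {v \<in> V. x i = v} = 1" by simp
      qed
    qed (use V \<open>finite I\<close> in auto)
    \<comment> \<open>The total degree is \<open>2 * card J\<close> plus twice the number of
      remaining edges.\<close>
    ultimately show "even ((\<Sum>v\<in>V. t v) + card ?J)" by (simp add: t_def sum.distrib)
    fix i assume "i \<in> ?J"
    then show "g i \<in> V \<times> V" "fst (g i) \<noteq> snd (g i)"
      using g[of i] h(1)[of i] by (auto simp: mem_Times_iff)
  qed (use V \<open>finite I\<close> con in auto)
  then obtain s where s: "\<And>i. i \<in> ?J \<Longrightarrow> s i \<in> ends g i" "\<And>v. v \<in> V \<Longrightarrow> even (t v + card {i \<in> ?J. s i = v})"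
    unfolding ends_def by blast
  define e where "e = (\<lambda>i. if i \<in> J then g i else (x i, s i))"
  have e: "e i \<in> h i \<times> h i" "fst (e i) \<noteq> snd (e i)" if "i \<in> I" for i
  proof -
    have "ends g i \<subseteq> h i" using g(1)[OF that] by (auto simp: ends_def)
    then show "e i \<in> h i \<times> h i" using g(1)[OF that] x(1)[OF that] s(1)[of i] that by (auto simp: e_def)
    show "fst (e i) \<noteq> snd (e i)" using g(2)[OF that] x(2)[OF that] s(1)[of i] that by (auto simp: e_def)
  qed
  have ev: "even (card {i \<in> I. v \<in> ends e i})" for v
  proof (cases "v \<in> V")
    case True
    have "{i \<in> I. v \<in> ends e i} = {i \<in> J. v \<in> ends g i} \<union> ({i \<in> ?J. x i = v} \<union> {i \<in> ?J. s i = v})"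
      using J by (auto simp: e_def ends_def)
    also have "card \<dots> = card {i \<in> J. v \<in> ends g i} + card ({i \<in> ?J. x i = v} \<union> {i \<in> ?J. s i = v})"
      using \<open>finite I\<close> finJ by (intro card_Un_disjoint) auto
    also have "card ({i \<in> ?J. x i = v} \<union> {i \<in> ?J. s i = v}) = card {i \<in> ?J. x i = v} + card {i \<in> ?J. s i = v}"
    proof (rule card_Un_disjoint)
      show "{i \<in> ?J. x i = v} \<inter> {i \<in> ?J. s i = v} = {}" using x(2) s(1) by fastforce
    qed (use \<open>finite I\<close> in auto)
    finally show ?thesis using s(2)[OF True] by (simp only: t_def add.assoc)
  next
    case False
    then have no: "{i \<in> I. v \<in> ends e i} = {}" using e(1) h(1) by (fastforce simp: ends_def)
    show ?thesis unfolding no by simp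
  qed
  have "g ` J \<subseteq> e ` I" using J by (force simp: e_def)
  then have "(u, v) \<in> conn (e ` I)" if "u \<in> V" "v \<in> V" for u v
    using con(1)[OF that] conn_mono[of "g ` J" "e ` I"] by blast
  with e ev show ?thesis by blast
qed

section \<open>Spanning Euler tours\<close>

text \<open>Positions in a list enumerate the multiset, so that repeated edges become distinct
  indices.\<close>

lemma hdeg_mset: "hdeg (mset L) T = card {i \<in> {..<length L}. T \<subseteq> L ! i}"
  by (simp add: hdeg_def length_filter_conv_card flip: mset_filter)

lemma has_spanning_euler_tour_if_pair_degrees:
  assumes "hypergraph V E" "E \<noteq> {#}" and E: "\<And>e. e \<in># E \<Longrightarrow> 3 \<le> card e \<and> card e \<le> k"
    and n: "2 * (k - 1) \<le> card V"
    and deg: "\<And>u v. u \<in> V \<Longrightarrow> v \<in> V \<Longrightarrow> u \<noteq> v \<Longrightarrow> k \<le> hdeg E {u, v}"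
  shows "has_spanning_euler_tour V E"
proof -
  obtain L where L: "mset L = E" using ex_mset by blast
  define I where "I = {..<length L}"
  let ?h = "\<lambda>i. L ! i"
  have V: "finite V" and EV: "\<And>e. e \<in># E \<Longrightarrow> e \<subseteq> V" using assms(1) by (auto simp: hypergraph_def)
  have LE: "?h i \<in># E" if "i \<in> I" for i using that by (auto simp: I_def L[symmetric])
  have "L \<noteq> []" using assms(2) L by auto
  then have I: "0 \<in> I" by (simp add: I_def)
  have card3: "3 \<le> card V"
    using E[OF LE[OF I]] card_mono[OF V EV[OF LE[OF I]]] by simp
  have "\<exists>e. (\<forall>i\<in>I. e i \<in> ?h i \<times> ?h i \<and> fst (e i) \<noteq> snd (e i)) \<and>
    (\<forall>v. even (card {i \<in> I. v \<in> ends e i})) \<and> (\<forall>u\<in>V. \<forall>v\<in>V. (u, v) \<in> conn (e ` I))"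
  proof (rule even_connected_representatives[OF V _ _ _ n])
    show "V \<noteq> {}" "finite I" using card3 by (auto simp: I_def)
    show "k \<ge> 2" using E[OF LE[OF I]] by simp
    show "k \<le> card {i \<in> I. u \<in> ?h i \<and> v \<in> ?h i}" if "u \<in> V" "v \<in> V" "u \<noteq> v" for u v
      using deg[OF that] hdeg_mset[of L "{u, v}"] by (simp add: L I_def)
  qed (use LE E EV in auto)
  then obtain e where e: "\<And>i. i \<in> I \<Longrightarrow> e i \<in> ?h i \<times> ?h i" "\<And>i. i \<in> I \<Longrightarrow> fst (e i) \<noteq> snd (e i)"
    and ev: "\<And>v. even (card {i \<in> I. v \<in> ends e i})"
    and con: "\<And>u v. u \<in> V \<Longrightarrow> v \<in> V \<Longrightarrow> (u, v) \<in> conn (e ` I)" by blast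
  have eV: "ends e i \<subseteq> ?h i" "ends e i \<subseteq> V" if "i \<in> I" for i
    using e(1)[OF that] EV[OF LE[OF that]] by (auto simp: ends_def)
  have "\<exists>u p. trail e u p u \<and> distinct (map snd p) \<and> snd ` set p = I"
    using e(2) ev con eV(2) by (intro euler_circuit) (auto simp: I_def ends_def)
  then obtain u p where p: "trail e u p u" "distinct (map snd p)" "snd ` set p = I" by blast
  define vs where "vs = map fst p"
  define es where "es = map (\<lambda>d. ?h (snd d)) p"
  have p0: "length p > 0" using p(3) I by auto
  then have u: "u = vs ! 0" using p(1) by (cases p) (auto simp: vs_def)
  \<comment> \<open>At the last position the index wraps around to 0, which matches the return of
    the closed trail to its first vertex \<open>u\<close>.\<close>
  have nth: "ends e (snd (p ! m)) = {vs ! m, vs ! ((m + 1) mod length vs)}" if "m < length p" for m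
    using trail_nth[OF p(1) that] that p0 u
    by (cases "Suc m < length p") (auto simp: vs_def not_less le_Suc_eq dest: le_antisym)
  have "closed_walk vs es"
    unfolding closed_walk_def
  proof (intro conjI allI impI)
    fix m assume "m < length vs"
    then have m: "m < length p" by (simp add: vs_def)
    then have i: "snd (p ! m) \<in> I" using p(3) by auto
    show "{vs ! m, vs ! ((m + 1) mod length vs)} \<subseteq> es ! m"
      using eV(1)[OF i] nth[OF m] m by (simp add: es_def)
    show "vs ! m \<noteq> vs ! ((m + 1) mod length vs)"
      using e(2)[OF i] nth[OF m] by (auto simp: ends_def doubleton_eq_iff)
  qed (use p0 in \<open>auto simp: vs_def es_def\<close>)
  moreover have "mset es = E"
  proof -
    have "mset (map snd p) = mset_set I" using mset_set_set[OF p(2)] p(3) by simp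
    moreover have "mset [0..<length L] = mset_set I" by (simp add: I_def atLeast0LessThan)
    ultimately have "image_mset ?h (mset (map snd p)) = image_mset ?h (mset [0..<length L])" by simp
    then have "mset (map ?h (map snd p)) = mset (map ?h [0..<length L])" by (simp only: mset_map)
    then show ?thesis by (simp only: map_nth L es_def map_map o_def)
  qed
  \<comment> \<open>Since \<open>V\<close> has a second vertex \<open>w\<close> connected to
    \<open>v\<close>, some chosen pair contains \<open>v\<close>; the trail uses that pair and hence
    visits \<open>v\<close>.\<close>
  moreover have "V \<subseteq> set vs"
  proof
    fix v assume v: "v \<in> V"
    have "V \<noteq> {v}" using card3 by auto
    then obtain w where w: "w \<in> V" "w \<noteq> v" using v by blast
    from con[OF v w(1)] have "(v, w) \<in> (e ` I \<union> (e ` I)\<inverse>)\<^sup>*" by (simp add: conn_def)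
    then have "\<exists>y. (v, y) \<in> e ` I \<union> (e ` I)\<inverse>"
    proof (cases rule: converse_rtranclE)
      case base
      then show ?thesis using w(2) by simp
    qed blast
    then obtain y where "(v, y) \<in> e ` I \<union> (e ` I)\<inverse>" ..
    then obtain i where "i \<in> I" "e i = (v, y) \<or> e i = (y, v)" by fastforce
    then have i: "i \<in> snd ` set p" "v \<in> ends e i" using p(3) by (auto simp: ends_def)
    have "u \<in> set vs" using u p0 by (simp add: vs_def)
    then show "v \<in> set vs" using trail_ends[OF p(1) i(1)] i(2) by (auto simp: vs_def)
  qed
  ultimately show ?thesis unfolding has_spanning_euler_tour_def euler_tour_def by blast
qed

section \<open>From the degree conditions and the size bound to pair degrees\<close>

lemma hdeg_extend:
  assumes "hypergraph V E" and E: "\<And>e. e \<in># E \<Longrightarrow> card e \<le> k" and "T \<subseteq> V"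
    and m: "\<And>w. w \<in> V - T \<Longrightarrow> m \<le> hdeg E (insert w T)"
  shows "m * (card V - card T) \<le> hdeg E T * (k - card T)"
proof -
  obtain L where L: "mset L = E" using ex_mset by blast
  let ?I = "{i \<in> {..<length L}. T \<subseteq> L ! i}"
  have V: "finite V" "finite T" using assms(1,3) finite_subset by (auto simp: hypergraph_def)
  \<comment> \<open>Count the incidences of vertices \<open>w\<close> outside \<open>T\<close> with
    edges that contain \<open>T\<close>: each \<open>w\<close> has at least \<open>m\<close>, each
    edge at most \<open>k - card T\<close>.\<close>
  have "m * (card V - card T) = (\<Sum>w\<in>V - T. m)"
    using V assms(3) by (simp add: card_Diff_subset)
  also have "\<dots> \<le> (\<Sum>w\<in>V - T. card {i \<in> ?I. w \<in> L ! i})"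
  proof (rule sum_mono)
    fix w assume "w \<in> V - T"
    have "{i \<in> ?I. w \<in> L ! i} = {i \<in> {..<length L}. insert w T \<subseteq> L ! i}" by auto
    then show "m \<le> card {i \<in> ?I. w \<in> L ! i}"
      using m[OF \<open>w \<in> V - T\<close>] hdeg_mset[of L "insert w T"] L by simp
  qed
  also have "\<dots> = (\<Sum>i\<in>?I. card {w \<in> V - T. w \<in> L ! i})"
    using V by (intro sum_multicount_gen) auto
  also have "\<dots> \<le> (\<Sum>i\<in>?I. k - card T)"
  proof (rule sum_mono)
    fix i assume i: "i \<in> ?I"
    then have LE: "L ! i \<in># E" by (auto simp: L[symmetric])
    then have fin: "finite (L ! i)" using assms(1) finite_subset by (auto simp: hypergraph_def)
    have "card {w \<in> V - T. w \<in> L ! i} \<le> card (L ! i - T)" using fin by (intro card_mono) auto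
    also have "\<dots> = card (L ! i) - card T" using V i by (intro card_Diff_subset) auto
    finally show "card {w \<in> V - T. w \<in> L ! i} \<le> k - card T" using E[OF LE] by linarith
  qed
  also have "\<dots> = hdeg E T * (k - card T)" using hdeg_mset[of L T] L by simp
  finally show ?thesis .
qed

lemma hdeg_antimono: "S \<subseteq> T \<Longrightarrow> hdeg E T \<le> hdeg E S"
  unfolding hdeg_def by (intro size_mset_mono) (auto simp: subseteq_mset_def)

lemma delta_le_hdeg:
  assumes "finite V" "T \<subseteq> V" "card T = t"
  shows "delta V E t \<le> hdeg E T"
  unfolding delta_def using assms by (intro Min_le) auto

lemma double_choose_two: "2 * (k choose 2) = k * (k - 1)"
proof -
  have "even (k * (k - 1))" by (cases k) auto
  then show ?thesis by (simp add: choose_two)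
qed

text \<open>A uniform lower bound extracted from the case distinction; at
  \<open>k = 2 * c - 1\<close> and \<open>k = 2 * c\<close> the denominator of the fraction is 4 and
  2 respectively.\<close>

lemma g_bound_ge:
  assumes "3 \<le> c" "c \<le> k"
  shows "real (k choose 2) + 1 \<le> g_bound c k \<mu>"
proof -
  have "real (2 * (k choose 2)) = real (k * (k - 1))" by (simp only: double_choose_two)
  then have d: "2 * real (k choose 2) = real k * (real k - 1)" using assms by (simp add: of_nat_diff)
  consider "c = 3 \<and> k = 3" | "c = 3 \<and> k = 4" | "c \<ge> 4 \<and> k \<le> 2*c - 2" | "k = 2*c - 1" | "k = 2*c" | "k > 2*c"
    using assms by linarith
  then show ?thesis
  proof cases
    case 4
    then have k: "real k = 2 * real c - 1" using assms by linarith
    have "g_bound c k \<mu> = (4 * real c ^ 2 + real k ^ 2 - 3 * real k + 2) / (4 * real c - 2 * real k + 2)"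
      using 4 assms by (auto simp: g_bound_def)
    also have "\<dots> = (4 * real c ^ 2 + real k ^ 2 - 3 * real k + 2) / 4" by (simp add: k)
    finally show ?thesis using d assms by (simp add: k power2_eq_square algebra_simps)
  next
    case 5
    have "g_bound c k \<mu> = (4 * real c ^ 2 + real k ^ 2 - 3 * real k + 2) / (4 * real c - 2 * real k + 2)"
      using 5 assms by (auto simp: g_bound_def)
    also have "\<dots> = (4 * real c ^ 2 + real k ^ 2 - 3 * real k + 2) / 2" by (simp add: 5)
    finally have "2 * g_bound c k \<mu> - 2 * (real (k choose 2) + 1) = 2 * real c * (2 * real c - 2)"
      using d by (simp add: 5 power2_eq_square algebra_simps)
    also have "\<dots> \<ge> 0" using assms by simp
    finally show ?thesis by simp
  next
    case 6
    \<comment> \<open>From \<open>k > 2 * c\<close> follows \<open>c \<le> k - c - 1\<close>, so the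
      term with factor \<open>\<mu>\<close> is nonnegative.\<close>
    have "(2::real) ^ c \<le> 2 ^ (k - c - 1)" using 6 by (intro power_increasing) auto
    then have "0 \<le> 2 * real \<mu> * (real k - 1) * (2 ^ (k - c - 1) - 2 ^ c + 1)"
      using assms by (intro mult_nonneg_nonneg) auto
    then show ?thesis using 6 assms by (auto simp: g_bound_def)
  qed (auto simp: g_bound_def choose_two)
qed

theorem theorem1p2:
  fixes V :: "'a set" and E :: "'a set multiset" and n c k \<mu> :: nat
  assumes "admissible V E n c k \<mu>"
    and "delta V E 2 \<ge> k
         \<or> (delta V E 3 \<ge> 1 \<and> int n \<ge> int k ^ 2 - 3 * int k + 5)
         \<or> (\<exists>r::nat. 4 \<le> r \<and> r \<le> k \<and> delta V E r \<ge> 1)"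
  shows "has_spanning_euler_tour V E"
proof -
  from assms(1) have hyp: "hypergraph V E" "E \<noteq> {#}" and n: "card V = n" "g_bound c k \<mu> \<le> real n"
    and c: "crk E = c" "3 \<le> c" and k: "rk E = k" by (auto simp: admissible_def)
  have V: "finite V" using hyp by (simp add: hypergraph_def)
  have E: "c \<le> card e \<and> card e \<le> k" if "e \<in># E" for e
    using that c(1) k by (auto simp: crk_def rk_def intro: Min_le Max_ge)
  have "c \<le> k" using E hyp(2) by (meson le_trans multiset_nonemptyE)
  then have k3: "3 \<le> k" using c by simp
  have "real (k choose 2) + 1 \<le> real n" using g_bound_ge[OF c(2) \<open>c \<le> k\<close>] n(2) by (rule order_trans)
  then have "real ((k choose 2) + 1) \<le> real n" by simp
  then have "(k choose 2) + 1 \<le> n" by (simp only: of_nat_le_iff)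
  then have n1: "k * (k - 1) + 2 \<le> 2 * n" using double_choose_two[of k] by simp
  then have "int (k * (k - 1) + 2) \<le> int (2 * n)" by (simp only: of_nat_le_iff)
  then have n2: "int k * (int k - 1) + 2 \<le> 2 * int n" using k3 by (simp add: of_nat_diff)
  \<comment> \<open>Expanded, this is \<open>4 * (k - 1) \<le> k * (k - 1) + 2\<close>.\<close>
  have "0 \<le> (int k - 3) * (int k - 2)" using k3 by (intro mult_nonneg_nonneg) auto
  then have "4 * (int k - 1) \<le> 2 * int n" using n2 by (simp add: algebra_simps)
  then have "int (2 * (k - 1)) \<le> int (card V)" using n(1) k3 by (simp add: of_nat_diff)
  then have nk: "2 * (k - 1) \<le> card V" by (simp only: of_nat_le_iff)
  have "k \<le> hdeg E {u, v}" if uv: "u \<in> V" "v \<in> V" "u \<noteq> v" for u v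
  proof -
    have cuv: "card {u, v} = 2" using uv by simp
    from assms(2) show ?thesis
    proof (elim disjE conjE exE)
      assume "k \<le> delta V E 2"
      then show ?thesis using delta_le_hdeg[OF V, of "{u, v}" 2 E] uv by simp
    next
      \<comment> \<open>The \<open>n - 2\<close> vertices outside the pair must be covered by its
        edges, each with at most \<open>k - 2\<close> further vertices. A pair degree of at most
        \<open>k - 1\<close> would give \<open>n - 2 \<le> (k - 1) * (k - 2)\<close>, that is,
        \<open>n\<close> at most \<open>k^2 - 3 * k + 4\<close>.\<close>
      assume d3: "1 \<le> delta V E 3" and n3: "int k ^ 2 - 3 * int k + 5 \<le> int n"
      have "1 * (card V - card {u, v}) \<le> hdeg E {u, v} * (k - card {u, v})"
      proof (rule hdeg_extend[OF hyp(1)])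
        fix w assume "w \<in> V - {u, v}"
        then show "1 \<le> hdeg E (insert w {u, v})"
          using delta_le_hdeg[OF V, of "insert w {u, v}" 3 E] uv d3 by auto
      qed (use E uv in auto)
      then have le: "n - 2 \<le> hdeg E {u, v} * (k - 2)" by (simp only: cuv n(1) mult_1)
      show ?thesis
      proof (rule ccontr)
        assume "\<not> ?thesis"
        then have "hdeg E {u, v} * (k - 2) \<le> (k - 1) * (k - 2)" by (intro mult_le_mono1) auto
        with le have "int (n - 2) \<le> int ((k - 1) * (k - 2))" by linarith
        then have "int n - 2 \<le> (int k - 1) * (int k - 2)" using k3 by (simp add: of_nat_diff)
        with n3 show False by (simp add: algebra_simps power2_eq_square)
      qed
    next
      fix r assume r: "4 \<le> r" "r \<le> k" and dr: "1 \<le> delta V E r"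
      obtain e where e: "e \<in># E" "card e = k"
        using k hyp(2) Max_in[of "card ` set_mset E"] by (auto simp: rk_def)
      then have "k \<le> card V" using hyp(1) V by (auto simp: hypergraph_def intro: card_mono)
      \<comment> \<open>A 4-set extends to an \<open>r\<close>-set, because
        \<open>r \<le> k \<le> card V\<close>; the edge containing the latter contains the
        former.\<close>
      have h4: "1 \<le> hdeg E T" if T: "T \<subseteq> V" "card T = 4" for T
      proof -
        obtain S where "T \<subseteq> S" "S \<subseteq> V" "card S = r"
          using exists_subset_between[of T r V] T r V \<open>k \<le> card V\<close> by auto
        then show ?thesis using delta_le_hdeg[OF V, of S r E] hdeg_antimono[of T S E] dr by linarith
      qed
      have h3: "n - 3 \<le> hdeg E T * (k - 3)" if "T \<subseteq> V" "card T = 3" for T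
      proof -
        have "finite T" using that V finite_subset by blast
        have "1 * (card V - card T) \<le> hdeg E T * (k - card T)"
          using E that \<open>finite T\<close> by (intro hdeg_extend[OF hyp(1)] h4) auto
        then show ?thesis using that n by simp
      qed
      \<comment> \<open>\<open>m\<close> is the least degree of a triple containing the pair.
        Extending triples to 4-sets bounds it from below, and extending the pair to triples passes
        this bound on to the pair.\<close>
      define m where "m = Min ((\<lambda>w. hdeg E (insert w {u, v})) ` (V - {u, v}))"
      let ?W = "V - {u, v}"
      have "?W \<noteq> {}"
      proof
        assume "?W = {}"
        then have "card V \<le> card {u, v}" by (intro card_mono) auto
        then show False using \<open>k \<le> card V\<close> r uv by simp
      qed
      then have "m \<in> (\<lambda>w. hdeg E (insert w {u, v})) ` ?W" unfolding m_def using V by (intro Min_in) auto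
      then obtain w where w: "w \<in> ?W" "m = hdeg E (insert w {u, v})" by blast
      then have m3: "n - 3 \<le> m * (k - 3)" using h3[of "insert w {u, v}"] uv by auto
      have "m * (card V - card {u, v}) \<le> hdeg E {u, v} * (k - card {u, v})"
        using E uv V by (intro hdeg_extend[OF hyp(1)]) (auto simp: m_def)
      then have m2: "m * (n - 2) \<le> hdeg E {u, v} * (k - 2)" by (simp only: cuv n(1))
      \<comment> \<open>Writing \<open>k = j + 4\<close> removes the truncated subtractions in
        \<open>k\<close>; both bounds on \<open>n\<close> restate
        \<open>k * (k - 1) + 2 \<le> 2 * n\<close>.\<close>
      obtain j where j: "k = j + 4" using r by (metis add.commute le_Suc_ex le_trans)
      have n_ge: "(j + 2) * (j + 5) \<le> 2 * (n - 2)" "j * j + 7 * j + 8 \<le> 2 * (n - 3)"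
        using n1 by (simp_all add: j algebra_simps)
      show ?thesis
      proof (rule ccontr)
        assume "\<not> ?thesis"
        then have d: "hdeg E {u, v} \<le> j + 3" by (simp add: j)
        \<comment> \<open>Multiplying the two counting bounds eliminates \<open>m\<close>. After
          cancelling \<open>j + 2\<close>, the left side \<open>j^3 + 12 * j^2 + 43 * j + 40\<close>
          exceeds the right side \<open>4 * j^2 + 16 * j + 12\<close>.\<close>
        have "((j + 2) * (j + 5)) * (j * j + 7 * j + 8) \<le> (2 * (n - 2)) * (2 * (n - 3))"
          using n_ge by (rule mult_le_mono)
        also have "\<dots> = 4 * ((n - 3) * (n - 2))" by simp
        also have "\<dots> \<le> 4 * ((m * (k - 3)) * (n - 2))" by (rule mult_le_mono2[OF mult_le_mono1[OF m3]])
        also have "\<dots> = 4 * ((m * (n - 2)) * (k - 3))" by (simp add: mult_ac)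
        also have "\<dots> \<le> 4 * ((hdeg E {u, v} * (k - 2)) * (k - 3))" by (rule mult_le_mono2[OF mult_le_mono1[OF m2]])
        also have "\<dots> \<le> 4 * (((j + 3) * (k - 2)) * (k - 3))" by (rule mult_le_mono2[OF mult_le_mono1[OF mult_le_mono1[OF d]]])
        also have "\<dots> = (j + 2) * (4 * ((j + 3) * (j + 1)))" by (simp add: j algebra_simps)
        finally have "(j + 2) * ((j + 5) * (j * j + 7 * j + 8)) \<le> (j + 2) * (4 * ((j + 3) * (j + 1)))"
          by (simp only: mult.assoc)
        then have "(j + 5) * (j * j + 7 * j + 8) \<le> 4 * ((j + 3) * (j + 1))"
          by (simp only: nat_mult_le_cancel_disj)
        then show False by (simp add: algebra_simps)
      qed
    qed
  qed
  then show ?thesis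
    using E c(2) by (intro has_spanning_euler_tour_if_pair_degrees[OF hyp _ nk]) fastforce+
qed

end
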